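(* Let $A, X \in \mathbb{C}^{m \times n}$, $W \in \mathbb{C}^{n \times m}$ be such that $k= \mathrm{ind}(A,W)$ and $r(WAW)=r(A)$. Then $X$ satisfies the system $$XWAWX=X, \quad WAWX=P_{\mathcal{R}(WA)}, \quad \mathcal{R}(X) \supseteq \mathcal{R}((AW)^k)$$ if and only if $X \in A\{1',2',3',{1^{k}}'\}$.
   Context: $r(\cdot)$ and $\mathcal{R}(\cdot)$ denote rank and range; $*$ is conjugate transpose; $P_{\mathcal{S}}$ is the orthogonal projector onto the subspace $\mathcal{S}$. The index $\mathrm{ind}(M)$ of a square matrix $M$ is the smallest non-negative integer $j$ with $r(M^j)=r(M^{j+1})$ (with $M^0=I$); $\mathrm{ind}(A,W)=\max\{\mathrm{ind}(AW),\mathrm{ind}(WA)\}$. $A\{1',2',3',{1^k}'\}$ is the set of all $X\in\mathbb{C}^{m\times n}$ with $AWXWA=A$, $XWAWX=X$, $(WAWX)^*=WAWX$ and $XW(AW)^{k+1}=(AW)^k$. *)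

theory Defs
  imports "HOL-Analysis.Analysis"
begin

text \<open>An \<open>m \<times> n\<close> complex matrix has type \<open>complex^'n^'m\<close>. Products are \<open>**\<close>; the overloaded
  \<open>*\<close> on this type is entrywise, so powers of square matrices need their own definition.\<close>

primrec matpow :: "'a::semiring_1^'n^'n \<Rightarrow> nat \<Rightarrow> 'a^'n^'n" where
  "matpow M 0 = mat 1"
| "matpow M (Suc j) = matpow M j ** M"

definition conj_transpose :: "complex^'n^'m \<Rightarrow> complex^'m^'n" where
  "conj_transpose M = (\<chi> i j. cnj (M $ j $ i))"

definition mat_range :: "'a::semiring_1^'n^'m \<Rightarrow> ('a^'m) set" where
  "mat_range M = range (\<lambda>x. M *v x)"

definition ind :: "'a::field^'n^'n \<Rightarrow> nat" where
  "ind M = (LEAST j. rank (matpow M j) = rank (matpow M (Suc j)))"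

definition weighted_ind :: "'a::field^'n^'m \<Rightarrow> 'a^'m^'n \<Rightarrow> nat" where
  "weighted_ind A W = max (ind (A ** W)) (ind (W ** A))"

text \<open>The library's \<open>inner\<close> on \<open>complex^'n\<close> is the real part of this form.\<close>

definition cinner :: "complex^'n \<Rightarrow> complex^'n \<Rightarrow> complex" where
  "cinner x y = (\<Sum>i\<in>UNIV. x $ i * cnj (y $ i))"

definition is_orth_projector :: "(complex^'n) set \<Rightarrow> complex^'n^'n \<Rightarrow> bool" where
  "is_orth_projector S P \<longleftrightarrow> (\<forall>x. P *v x \<in> S \<and> (\<forall>y\<in>S. cinner (x - P *v x) y = 0))"

text \<open>Meaningful when \<open>S\<close> is a complex subspace; see \<open>ex1_orth_projector\<close>.\<close>

definition orth_projector :: "(complex^'n) set \<Rightarrow> complex^'n^'n" where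
  "orth_projector S = (THE P. is_orth_projector S P)"

text \<open>The set \<open>A{1',2',3',1^k'}\<close> of \<open>W\<close>-weighted generalized inverses of \<open>A\<close>.\<close>

definition weighted_inverses ::
    "complex^'n^'m \<Rightarrow> complex^'m^'n \<Rightarrow> nat \<Rightarrow> (complex^'n^'m) set" where
  "weighted_inverses A W k = {X.
     A ** W ** X ** W ** A = A \<and>
     X ** W ** A ** W ** X = X \<and>
     conj_transpose (W ** A ** W ** X) = W ** A ** W ** X \<and>
     X ** W ** matpow (A ** W) (k + 1) = matpow (A ** W) k}"

lemma cinner_diff_left: "cinner (x - y) z = cinner x z - cinner y z"
  by (simp add: cinner_def sum_subtractf algebra_simps)

lemma cinner_add_left: "cinner (x + y) z = cinner x z + cinner y z"
  by (simp add: cinner_def sum.distrib algebra_simps)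

lemma cinner_scale_left: "cinner (c *s x) y = c * cinner x y"
  by (simp add: cinner_def sum_distrib_left mult.assoc)

lemma cinner_self_eq_0: "cinner x x = 0 \<longleftrightarrow> x = 0"
proof
  assume "cinner x x = 0"
  moreover have "cinner x x = of_real (\<Sum>i\<in>UNIV. (cmod (x $ i))\<^sup>2)"
    by (simp add: cinner_def complex_mult_cnj cmod_power2)
  ultimately have "(\<Sum>i\<in>UNIV. (cmod (x $ i))\<^sup>2) = 0"
    by (metis of_real_eq_0_iff)
  then show "x = 0"
    by (simp add: sum_nonneg_eq_0_iff vec_eq_iff)
qed (simp add: cinner_def)

lemma inner_eq_Re_cinner: "inner x y = Re (cinner x y)"
  by (simp add: cinner_def inner_vec_def inner_complex_def)

lemma orth_decomp_unique:
  assumes S: "vec.subspace S" and "u \<in> S" "v \<in> S"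
    and "\<forall>y\<in>S. cinner (x - u) y = 0" "\<forall>y\<in>S. cinner (x - v) y = 0"
  shows "u = v"
proof -
  have "u - v \<in> S" using assms by (simp add: vec.subspace_diff)
  then have "cinner (x - v) (u - v) - cinner (x - u) (u - v) = 0" using assms by simp
  then have "cinner (u - v) (u - v) = 0" by (simp add: cinner_diff_left[symmetric])
  then show ?thesis by (simp add: cinner_self_eq_0)
qed

lemma orth_decomp_exists:
  assumes S: "vec.subspace S"
  shows "\<exists>u\<in>S. \<forall>y\<in>S. cinner (x - u) y = 0"
proof -
  have scaleR: "c *\<^sub>R z = complex_of_real c *s z" for c and z :: "complex^'a"
    by (simp add: vec_eq_iff complex_eq_iff)
  have sub: "subspace S"
    unfolding subspace_def using S
    by (auto simp: scaleR vec.subspace_def)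
  obtain u z where u: "u \<in> span S" and z: "\<And>w. w \<in> span S \<Longrightarrow> orthogonal z w" and x: "x = u + z"
    using orthogonal_subspace_decomp_exists[of S x] by metis
  have uS: "u \<in> S" using u sub by (simp add: span_eq_iff[THEN iffD2])
  have Re0: "Re (cinner z w) = 0" if "w \<in> S" for w
    using z[of w] that by (simp add: orthogonal_def inner_eq_Re_cinner span_base)
  have "cinner (x - u) y = 0" if "y \<in> S" for y
  proof -
    have "\<i> *s y \<in> S" using S that by (simp add: vec.subspace_scale)
    moreover have "cinner z (\<i> *s y) = - \<i> * cinner z y"
      by (simp add: cinner_def sum_distrib_left sum_negf[symmetric] algebra_simps)
    ultimately have "Im (cinner z y) = 0" using Re0[of "\<i> *s y"] by simp
    then show ?thesis using Re0[OF that] x by (simp add: complex_eq_iff)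
  qed
  then show ?thesis using uS by blast
qed

lemma ex1_orth_projector:
  assumes S: "vec.subspace S"
  shows "\<exists>!P. is_orth_projector S P"
proof -
  obtain f where f: "\<And>x. f x \<in> S" "\<And>x y. y \<in> S \<Longrightarrow> cinner (x - f x) y = 0"
    using orth_decomp_exists[OF S] by metis
  have f_eq: "f x = u" if "u \<in> S" "\<forall>y\<in>S. cinner (x - u) y = 0" for x u
    using orth_decomp_unique[OF S f(1) that(1) _ that(2)] f(2) by blast
  have "f (x + y) = f x + f y" for x y
  proof (rule f_eq)
    show "\<forall>w\<in>S. cinner (x + y - (f x + f y)) w = 0"
      using f(2) cinner_add_left[of "x - f x" "y - f y"] by (simp add: algebra_simps)
  qed (use f(1) S in \<open>simp add: vec.subspace_add\<close>)
  moreover have "f (c *s x) = c *s f x" for c x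
  proof (rule f_eq)
    show "\<forall>w\<in>S. cinner (c *s x - c *s f x) w = 0"
      using f(2) cinner_scale_left[of c "x - f x"] by (simp add: vec.scale_right_diff_distrib)
  qed (use f(1) S in \<open>simp add: vec.subspace_scale\<close>)
  ultimately have lin: "Vector_Spaces.linear (*s) (*s) f"
    by unfold_locales (auto simp: vec.scale_right_distrib vec.scale_left_distrib)
  have "is_orth_projector S (matrix f)"
    using f by (simp add: is_orth_projector_def matrix_works[OF lin])
  moreover have "P = Q" if "is_orth_projector S P" "is_orth_projector S Q" for P Q
    using that orth_decomp_unique[OF S] unfolding is_orth_projector_def matrix_eq by blast
  ultimately show ?thesis by blast
qed

end

theory Submission
  imports Defs
begin

text \<open>
  Given \<open>XWAWX = X\<close>, the remaining conditions match one by one. A matrix is the orthogonal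
  projector onto \<open>R(WA)\<close> iff it is Hermitian, fixes \<open>WA\<close> and has range inside \<open>R(WA)\<close>; for
  \<open>WAWX\<close> the range condition is automatic, and \<open>WAWXWA = WA\<close> is equivalent to \<open>AWXWA = A\<close>
  because the rank hypothesis makes the null spaces of \<open>WA\<close> and \<open>A\<close> coincide. Finally \<open>XWAW\<close> is
  idempotent with range \<open>R(X)\<close>, so \<open>R(X)\<close> contains the range of \<open>(AW)^k\<close> iff \<open>XWAW\<close> fixes
  \<open>(AW)^k\<close>.
\<close>

lemma cinner_commute: "cinner x y = cnj (cinner y x)"
  by (simp add: cinner_def mult.commute)

lemma cinner_conj_transpose: "cinner (M *v x) y = cinner x (conj_transpose M *v y)"
proof -
  have "cinner (M *v x) y = (\<Sum>i\<in>UNIV. \<Sum>j\<in>UNIV. M $ i $ j * x $ j * cnj (y $ i))"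
    by (simp add: cinner_def matrix_vector_mult_def sum_distrib_right)
  also have "\<dots> = (\<Sum>j\<in>UNIV. \<Sum>i\<in>UNIV. M $ i $ j * x $ j * cnj (y $ i))"
    by (rule sum.swap)
  also have "\<dots> = cinner x (conj_transpose M *v y)"
    by (simp add: cinner_def matrix_vector_mult_def conj_transpose_def sum_distrib_left mult_ac)
  finally show ?thesis .
qed

text \<open>Restates Hermitian symmetry through \<open>cinner\<close>, the language in which
  \<open>is_orth_projector\<close> is phrased.\<close>

lemma conj_transpose_eq_iff:
  "conj_transpose M = M \<longleftrightarrow> (\<forall>x y. cinner (M *v x) y = cinner x (M *v y))"
proof
  assume sym: "\<forall>x y. cinner (M *v x) y = cinner x (M *v y)"
  have "conj_transpose M *v x = M *v x" for x
  proof -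
    let ?d = "conj_transpose M *v x - M *v x"
    have "cinner (conj_transpose M *v x) ?d = cinner (M *v x) ?d"
      using sym cinner_conj_transpose[of M ?d x] cinner_commute[of _ ?d] by simp
    then have "cinner ?d ?d = 0"
      by (simp add: cinner_diff_left)
    then show ?thesis by (simp add: cinner_self_eq_0)
  qed
  then show "conj_transpose M = M" by (simp add: matrix_eq)
qed (metis cinner_conj_transpose)

lemma subspace_mat_range: "vec.subspace (mat_range (M :: 'a::field^'n^'m))"
  unfolding mat_range_def
  by (rule vec.subspace_image[OF vec.subspace_UNIV])

lemma mat_range_mult_subset: "mat_range (M ** N) \<subseteq> mat_range M"
  by (auto simp: mat_range_def matrix_vector_mul_assoc[symmetric])

text \<open>Preimages of the columns of \<open>N\<close> under \<open>M\<close> are the columns of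
  \<open>Y\<close>. Range inclusions thus become factorizations, open to matrix algebra.\<close>

lemma mat_range_subset_iff:
  fixes M :: "'a::comm_semiring_1^'n^'m" and N :: "'a^'p^'m"
  shows "mat_range N \<subseteq> mat_range M \<longleftrightarrow> (\<exists>Y. N = M ** Y)"
proof
  assume sub: "mat_range N \<subseteq> mat_range M"
  have "\<forall>j. \<exists>y. N *v axis j 1 = M *v y"
    using sub by (auto simp: mat_range_def)
  then obtain y where y: "\<And>j. N *v axis j 1 = M *v y j" by metis
  have "N = M ** (\<chi> i j. y j $ i)"
    using y by (simp add: vec_eq_iff matrix_matrix_mult_def matrix_vector_mult_def axis_def
        if_distrib cong: if_cong)
  then show "\<exists>Y. N = M ** Y" ..
qed (use mat_range_mult_subset in auto)

lemma orth_projector_eq_iff: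
  assumes "vec.subspace S"
  shows "orth_projector S = P \<longleftrightarrow> is_orth_projector S P"
  using theI'[OF ex1_orth_projector[OF assms]] ex1_orth_projector[OF assms]
  unfolding orth_projector_def by blast

lemma is_orth_projector_mat_range_iff:
  "is_orth_projector (mat_range M) P \<longleftrightarrow>
     conj_transpose P = P \<and> P ** M = M \<and> mat_range P \<subseteq> mat_range M"
proof
  assume P: "is_orth_projector (mat_range M) P"
  have ran: "P *v x \<in> mat_range M" for x
    using P by (simp add: is_orth_projector_def)
  have orth: "cinner (P *v x) y = cinner x y" if "y \<in> mat_range M" for x y
  proof -
    have "cinner (x - P *v x) y = 0"
      using P that unfolding is_orth_projector_def by blast
    then show ?thesis unfolding cinner_diff_left by simp
  qed
  have "conj_transpose P = P"
    unfolding conj_transpose_eq_iff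
  proof (intro allI)
    fix x y
    \<comment> \<open>\<open>orth\<close> removes \<open>P\<close> from the first argument only, so
      the arguments are swapped by conjugation.\<close>
    have "cinner (P *v x) y = cinner (P *v x) (P *v y)"
      unfolding cinner_commute[of "P *v x"] by (simp only: orth[OF ran])
    then show "cinner (P *v x) y = cinner x (P *v y)"
      by (simp only: orth[OF ran])
  qed
  moreover have "P *v (M *v x) = M *v x" for x
  \<comment> \<open>Both sides are orthogonal projections of \<open>M *v x\<close>, which lies in
    the range itself and so leaves residual 0.\<close>
  proof (rule orth_decomp_unique[OF subspace_mat_range[of M], of _ _ "M *v x"])
    show "M *v x \<in> mat_range M" by (simp add: mat_range_def)
  qed (use ran in \<open>simp_all add: cinner_diff_left orth cinner_def[of 0]\<close>)
  then have "P ** M = M"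
    by (simp add: matrix_eq matrix_vector_mul_assoc)
  moreover have "mat_range P \<subseteq> mat_range M"
    using ran by (auto simp: mat_range_def[of P])
  ultimately show "conj_transpose P = P \<and> P ** M = M \<and> mat_range P \<subseteq> mat_range M" by simp
next
  assume P: "conj_transpose P = P \<and> P ** M = M \<and> mat_range P \<subseteq> mat_range M"
  have "cinner (x - P *v x) (M *v y) = 0" for x y
  proof -
    have "cinner (P *v x) (M *v y) = cinner x ((P ** M) *v y)"
      using P by (simp add: cinner_conj_transpose matrix_vector_mul_assoc)
    then show ?thesis using P by (simp add: cinner_diff_left)
  qed
  then show "is_orth_projector (mat_range M) P"
    using P by (auto simp: is_orth_projector_def mat_range_def)
qed

text \<open>\<open>matpow\<close> grows on the right, but in
  \<open>X ** W ** matpow (A ** W) (k + 1)\<close> the factor next to \<open>W\<close> must be split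
  off.\<close>

lemma matpow_Suc_left: "matpow M (Suc j) = M ** matpow M j"
  by (induction j) (simp_all add: matrix_mul_assoc[symmetric])

lemma rows_mult_subset_span: "rows (M ** N) \<subseteq> vec.span (rows (N :: 'a::field^'n^'m))"
proof -
  have "row i (M ** N) = (\<Sum>j\<in>UNIV. M $ i $ j *s row j N)" for i
    by (simp add: vec_eq_iff row_def matrix_matrix_mult_def)
  moreover have "row j N \<in> vec.span (rows N)" for j
    by (auto simp: rows_def intro: vec.span_base)
  ultimately have "row i (M ** N) \<in> vec.span (rows N)" for i
    by (simp add: vec.span_sum vec.span_scale)
  then show ?thesis
    by (auto simp: rows_def[of "M ** N"])
qed

text \<open>The rows of \<open>M ** N\<close> are the images of the rows of \<open>M\<close> under
  \<open>transpose N\<close>, and a linear map does not raise dimension.\<close>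

lemma rank_mult_le_left: "rank (M ** N) \<le> rank (M :: 'a::field^'n^'m)"
proof -
  have "rows (M ** N) = (*v) (transpose N) ` rows M"
    by (auto simp: rows_def row_def vec_eq_iff matrix_matrix_mult_def matrix_vector_mult_def
        transpose_def mult.commute image_def)
  then show ?thesis
    unfolding row_rank_def_gen
    by (simp only: vec.dim_image_le[OF matrix_vector_mul_linear_gen])
qed

text \<open>Equal ranks force equal row spaces, hence equal null spaces.\<close>

lemma rank_mult_eq_cancel:
  fixes M :: "'a::field^'m^'p" and N :: "'a^'n^'m"
  assumes rank: "rank N \<le> rank (M ** N)" and eq: "M ** N ** Y = M ** N ** Z"
  shows "N ** Y = N ** Z"
proof -
  have "vec.span (rows (M ** N)) \<subseteq> vec.span (rows N)"
    by (simp add: rows_mult_subset_span vec.span_minimal)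
  then have span: "vec.span (rows (M ** N)) = vec.span (rows N)"
    using rank vec.subspace_dim_equal[OF vec.subspace_span vec.subspace_span]
    by (simp add: row_rank_def_gen)
  \<comment> \<open>The equation is linear in \<open>r\<close>, so it passes from the rows of
    \<open>M ** N\<close> to their span, which contains the rows of \<open>N\<close>.\<close>
  have "(\<Sum>l\<in>UNIV. r $ l * Y $ l $ j) = (\<Sum>l\<in>UNIV. r $ l * Z $ l $ j)"
    if "r \<in> vec.span (rows (M ** N))" for r j
    using that
  proof (induction rule: vec.span_induct_alt)
    case (step c x y)
    then have "(\<Sum>l\<in>UNIV. x $ l * Y $ l $ j) = (\<Sum>l\<in>UNIV. x $ l * Z $ l $ j)"
      using eq unfolding rows_def row_def
      by (auto simp: vec_eq_iff matrix_matrix_mult_def)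
    then show ?case using step
      by (simp add: algebra_simps sum.distrib flip: sum_distrib_left)
  qed simp
  moreover have "row i N \<in> vec.span (rows (M ** N))" for i
    unfolding span by (auto simp: rows_def intro: vec.span_base)
  ultimately show ?thesis
    by (simp add: vec_eq_iff matrix_matrix_mult_def row_def)
qed

theorem theorem4p7:
  fixes A X :: "complex^'n^'m" and W :: "complex^'m^'n" and k :: nat
  assumes "k = weighted_ind A W"
    and "rank (W ** A ** W) = rank A"
  shows "(X ** W ** A ** W ** X = X \<and>
          W ** A ** W ** X = orth_projector (mat_range (W ** A)) \<and>
          mat_range X \<supseteq> mat_range (matpow (A ** W) k))
         \<longleftrightarrow> X \<in> weighted_inverses A W k"
proof -
  let ?P = "W ** A ** W ** X" and ?M = "matpow (A ** W)"
  have proj: "?P = orth_projector (mat_range (W ** A)) \<longleftrightarrow>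
      conj_transpose ?P = ?P \<and> A ** W ** X ** W ** A = A"
  proof -
    have "?P ** (W ** A) = W ** A \<longleftrightarrow> A ** W ** X ** W ** A = A"
    proof
      assume "?P ** (W ** A) = W ** A"
      moreover have "rank A \<le> rank (W ** A)"
        using rank_mult_le_left[of "W ** A" W] assms(2) by simp
      \<comment> \<open>The leading \<open>W\<close> is cancelled; \<open>mat 1\<close> supplies the
        right factor that the cancellation rule expects.\<close>
      ultimately have "A ** (W ** X ** W ** A) = A ** mat 1"
        by (intro rank_mult_eq_cancel[of A W]) (simp_all add: matrix_mul_assoc)
      then show "A ** W ** X ** W ** A = A" by (simp add: matrix_mul_assoc)
    next
      assume "A ** W ** X ** W ** A = A"
      then have "W ** (A ** W ** X ** W ** A) = W ** A" by simp
      then show "?P ** (W ** A) = W ** A" by (simp add: matrix_mul_assoc)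
    qed
    moreover have "mat_range ?P \<subseteq> mat_range (W ** A)"
      using mat_range_mult_subset[of "W ** A" "W ** X"] by (simp add: matrix_mul_assoc)
    ultimately show ?thesis
      using orth_projector_eq_iff[OF subspace_mat_range, of "W ** A" ?P]
        is_orth_projector_mat_range_iff[of "W ** A" ?P] by auto
  qed
  have "mat_range (?M k) \<subseteq> mat_range X \<longleftrightarrow> X ** W ** ?M (k + 1) = ?M k"
    if X: "X ** W ** A ** W ** X = X"
  proof -
    have "X ** W ** ?M (k + 1) = X ** W ** A ** W ** ?M k"
      using matpow_Suc_left[of "A ** W" k] by (simp add: matrix_mul_assoc)
    \<comment> \<open>Any matrix that factors through \<open>X\<close> is fixed by
      \<open>X ** W ** A ** W\<close>; conversely, a fixed \<open>?M k\<close> factors through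
      \<open>X\<close> with cofactor \<open>W ** A ** W ** ?M k\<close>.\<close>
    moreover have "X ** W ** A ** W ** (X ** Y) = X ** Y" for Y :: "complex^'m^'n"
      using X by (simp add: matrix_mul_assoc)
    moreover have "?M k = X ** (W ** A ** W ** ?M k)" if "X ** W ** A ** W ** ?M k = ?M k"
      using that by (simp add: matrix_mul_assoc)
    ultimately show ?thesis
      unfolding mat_range_subset_iff by metis
  qed
  with proj show ?thesis
    unfolding weighted_inverses_def by auto
qed

end
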